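(* Let $N$ be a densely defined linear operator in a real or complex Hilbert space $\mathcal{H}$. The following assertions are equivalent: (i) $N$ is normal. (ii) $N^*N$ and $NN^*$ are selfadjoint operators such that $N^*N=NN^*$. (iii) $N^*N$ and $NN^*$ are adjoint of each other, i.e. both are densely defined, $(N^*N)^*=NN^*$ and $(NN^* )^*=N^*N$. (iv) $N^*N$ and $NN^*$ are adjoint to each other and a) $G(N^*N)^{\perp}\subseteq\operatorname{ran}(M_{N^*N,\,NN^*})$, b) $G(NN^* )^{\perp}\subseteq\operatorname{ran}(M_{NN^*,\,N^*N})$.
   Context: Linear operators are defined on linear subspaces; products have their natural domains; equality of operators includes equality of domains. $N$ is normal if it is densely defined, closed, and the (selfadjoint) operators $N^*N$ and $NN^*$ are identical. Selfadjoint means densely defined and equal to its adjoint. Operators $A,B$ in $\mathcal{H}$ are adjoint to each other if $(Ah\mid k)=(h\mid Bk)$ for all $h\in\operatorname{dom}A$, $k\in\operatorname{dom}B$. $G(A)=\{(h,Ah):h\in\operatorname{dom}A\}$ is the graph and $\perp$ is taken in the product Hilbert space $\mathcal{H}\times\mathcal{H}$. $M_{A,B}$ is the operator in $\mathcal{H}\times\mathcal{H}$ with domain $\operatorname{dom}A\times\operatorname{dom}B$ given by $M_{A,B}(h,k)=(h-Bk,\,Ah+k)$. *)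

theory Defs
  imports "HOL-Analysis.Analysis"
begin

text \<open>
  The scalar field: real or complex numbers, treated uniformly. The two axioms already imply that
  conjugation is a real-linear involution and that every scalar \<open>x\<close> is a root of the real quadratic
  \<open>X\<^sup>2 - (x + conj x) X + (norm x)\<^sup>2\<close>, so that up to isomorphism the instances are exactly
  \<open>real\<close> (with trivial conjugation) and \<open>complex\<close>.
\<close>

class real_or_complex = real_normed_field +
  fixes scalar_conj :: "'a \<Rightarrow> 'a"
  assumes scalar_conj_add: "scalar_conj (x + y) = scalar_conj x + scalar_conj y"
    and mult_scalar_conj: "x * scalar_conj x = (norm x)\<^sup>2 *\<^sub>R 1"

instantiation real :: real_or_complex
begin

definition scalar_conj_real :: "real \<Rightarrow> real"
  where "scalar_conj_real x = x"

instance
  by standard (simp_all add: scalar_conj_real_def power2_eq_square)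

end

instantiation complex :: real_or_complex
begin

definition scalar_conj_complex :: "complex \<Rightarrow> complex"
  where "scalar_conj_complex = cnj"

instance
  by standard (simp_all add: scalar_conj_complex_def complex_norm_square scaleR_conv_of_real flip: of_real_power)

end

text \<open>
  The carrier type supplies norm, topology and completeness; the last axiom says that this norm is
  the one induced by the scalar product. The library's real product \<open>inner\<close> is then forced to be
  the real part of \<open>ip\<close>, so working over \<open>real_inner\<close> costs no generality.
\<close>

locale hilbert_space = vector_space smul
  for smul :: "'k::real_or_complex \<Rightarrow> 'a::{real_inner, banach} \<Rightarrow> 'a" +
  fixes ip :: "'a \<Rightarrow> 'a \<Rightarrow> 'k"
  assumes ip_add_left: "ip (x + y) z = ip x z + ip y z"
    and ip_smul_left: "ip (smul c x) y = c * ip x y"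
    and ip_commute: "ip y x = scalar_conj (ip x y)"
    and ip_self: "ip x x = of_real ((norm x)\<^sup>2)"

lemma hilbert_space_real:
  "hilbert_space scaleR (inner :: 'a::{real_inner, banach} \<Rightarrow> 'a \<Rightarrow> real)"
  by unfold_locales
    (simp_all add: algebra_simps inner_commute scalar_conj_real_def power2_norm_eq_inner)

lemma hilbert_space_complex: "hilbert_space (*) (\<lambda>x y :: complex. x * cnj y)"
  by unfold_locales
    (simp_all add: algebra_simps scalar_conj_complex_def complex_norm_square del: of_real_power)

definition prod_smul :: "('k \<Rightarrow> 'a \<Rightarrow> 'a) \<Rightarrow> 'k \<Rightarrow> 'a \<times> 'a \<Rightarrow> 'a \<times> 'a"
  where "prod_smul smul c u = (smul c (fst u), smul c (snd u))"

definition prod_ip :: "('a \<Rightarrow> 'a \<Rightarrow> 'k::plus) \<Rightarrow> 'a \<times> 'a \<Rightarrow> 'a \<times> 'a \<Rightarrow> 'k"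
  where "prod_ip ip u v = ip (fst u) (fst v) + ip (snd u) (snd v)"

lemma hilbert_space_prod:
  assumes "hilbert_space smul ip"
  shows "hilbert_space (prod_smul smul) (prod_ip ip)"
proof -
  interpret hilbert_space smul ip by fact
  show ?thesis
  proof
    fix u v :: "'b \<times> 'b"
    show "prod_ip ip v u = scalar_conj (prod_ip ip u v)"
      unfolding prod_ip_def scalar_conj_add by (simp only: ip_commute[symmetric])
    show "prod_ip ip u u = of_real ((norm u)\<^sup>2)"
      by (simp add: prod_ip_def ip_self norm_prod_def flip: of_real_add of_real_power)
  qed (auto simp: prod_smul_def prod_ip_def scale_right_distrib scale_left_distrib
      ip_add_left ip_smul_left algebra_simps)
qed

definition orth_compl :: "('a \<Rightarrow> 'a \<Rightarrow> 'k::zero) \<Rightarrow> 'a set \<Rightarrow> 'a set"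
  where "orth_compl ip S = {v. \<forall>u\<in>S. ip u v = 0}"

text \<open>
  Operators are partial maps \<open>'a \<rightharpoonup> 'a\<close>. Thus \<open>dom\<close>, \<open>ran\<close>, \<open>Map.graph\<close> are the domain, range and
  graph, equality includes equality of domains, and \<open>A \<circ>\<^sub>m B\<close> is the product \<open>AB\<close> with its natural
  domain \<open>{x \<in> dom B. the (B x) \<in> dom A}\<close>.
\<close>

definition linear_operator ::
    "('k::field \<Rightarrow> 'a::ab_group_add \<Rightarrow> 'a) \<Rightarrow> ('a \<rightharpoonup> 'a) \<Rightarrow> bool"
  where "linear_operator smul A \<longleftrightarrow>
    module.subspace smul (dom A) \<and>
    (\<forall>x\<in>dom A. \<forall>y\<in>dom A. the (A (x + y)) = the (A x) + the (A y)) \<and>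
    (\<forall>c. \<forall>x\<in>dom A. the (A (smul c x)) = smul c (the (A x)))"

definition densely_defined :: "('a::topological_space \<rightharpoonup> 'a) \<Rightarrow> bool"
  where "densely_defined A \<longleftrightarrow> closure (dom A) = UNIV"

definition closed_operator :: "('a::topological_space \<rightharpoonup> 'a) \<Rightarrow> bool"
  where "closed_operator A \<longleftrightarrow> closed (Map.graph A)"

text \<open>
  For densely defined \<open>A\<close> the vector \<open>l\<close> below is unique whenever it exists, so that the domain is
  \<open>{k. \<exists>l. \<forall>h\<in>dom A. ip (the (A h)) k = ip h l}\<close>. Otherwise the value is meaningless, so uses of
  \<open>op_adjoint\<close> come with a density requirement.
\<close>

definition op_adjoint :: "('a \<Rightarrow> 'a \<Rightarrow> 'k) \<Rightarrow> ('a \<rightharpoonup> 'a) \<Rightarrow> ('a \<rightharpoonup> 'a)"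
  where "op_adjoint ip A = (\<lambda>k.
    if \<exists>!l. \<forall>h\<in>dom A. ip (the (A h)) k = ip h l
    then Some (THE l. \<forall>h\<in>dom A. ip (the (A h)) k = ip h l)
    else None)"

definition selfadjoint :: "('a \<Rightarrow> 'a \<Rightarrow> 'k) \<Rightarrow> ('a::topological_space \<rightharpoonup> 'a) \<Rightarrow> bool"
  where "selfadjoint ip A \<longleftrightarrow> densely_defined A \<and> op_adjoint ip A = A"

definition normal_operator :: "('a \<Rightarrow> 'a \<Rightarrow> 'k) \<Rightarrow> ('a::topological_space \<rightharpoonup> 'a) \<Rightarrow> bool"
  where "normal_operator ip N \<longleftrightarrow>
    densely_defined N \<and> closed_operator N \<and> op_adjoint ip N \<circ>\<^sub>m N = N \<circ>\<^sub>m op_adjoint ip N"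

definition adjoint_of_each_other ::
    "('a \<Rightarrow> 'a \<Rightarrow> 'k) \<Rightarrow> ('a::topological_space \<rightharpoonup> 'a) \<Rightarrow> ('a \<rightharpoonup> 'a) \<Rightarrow> bool"
  where "adjoint_of_each_other ip A B \<longleftrightarrow>
    densely_defined A \<and> densely_defined B \<and> op_adjoint ip A = B \<and> op_adjoint ip B = A"

text \<open>The weaker relation of formal adjointness, which does not require dense domains.\<close>

definition adjoint_to_each_other :: "('a \<Rightarrow> 'a \<Rightarrow> 'k) \<Rightarrow> ('a \<rightharpoonup> 'a) \<Rightarrow> ('a \<rightharpoonup> 'a) \<Rightarrow> bool"
  where "adjoint_to_each_other ip A B \<longleftrightarrow>
    (\<forall>h\<in>dom A. \<forall>k\<in>dom B. ip (the (A h)) k = ip h (the (B k)))"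

definition block_operator ::
    "('a::ab_group_add \<rightharpoonup> 'a) \<Rightarrow> ('a \<rightharpoonup> 'a) \<Rightarrow> ('a \<times> 'a \<rightharpoonup> 'a \<times> 'a)"
  where "block_operator A B = (\<lambda>(h, k).
    if h \<in> dom A \<and> k \<in> dom B then Some (h - the (B k), the (A h) + k) else None)"

end

theory Submission
  imports Defs
begin

text \<open>
  If \<open>A\<close> and \<open>B\<close> are adjoint to each other, a vector of \<open>G(A)\<^sup>\<bottom>\<close> of the form \<open>(h - Bk, Ah + k)\<close> has
  scalar product \<open>\<parallel>h\<parallel>\<^sup>2 + \<parallel>Ah\<parallel>\<^sup>2 = 0\<close> with \<open>(h, Ah)\<close>, hence equals \<open>(-Bk, k)\<close>; so the range condition says
  that \<open>A\<close> is densely defined with adjoint \<open>B\<close>. Since \<open>N\<^sup>*N\<close> and \<open>NN\<^sup>*\<close> are symmetric, being adjoint of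
  each other forces them to be equal and selfadjoint. Finally, \<open>N\<close> is closed iff \<open>I + N\<^sup>*N\<close> and \<open>I + NN\<^sup>*\<close>
  are onto, iff \<open>N\<^sup>*N\<close> and \<open>NN\<^sup>*\<close> are selfadjoint.
\<close>

subsection \<open>Orthogonal projection onto a closed subspace\<close>

text \<open>The parallelogram law for \<open>x - y\<close> and \<open>x - z\<close>, solved for
  their difference. In this form it makes sequences that minimize the distance to \<open>x\<close>
  Cauchy.\<close>

lemma norm_diff_midpoint:
  fixes x y z :: "'a::real_inner"
  shows "(norm (y - z))\<^sup>2 =
    2 * (norm (x - y))\<^sup>2 + 2 * (norm (x - z))\<^sup>2 - 4 * (norm (x - (1/2) *\<^sub>R (y + z)))\<^sup>2"
  by (simp add: power2_norm_eq_inner inner_diff inner_add inner_commute algebra_simps)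

lemma norm_diff_scaleR:
  fixes u v :: "'a::real_inner"
  shows "(norm (v - r *\<^sub>R u))\<^sup>2 = (norm v)\<^sup>2 - 2 * r * inner u v + r\<^sup>2 * (norm u)\<^sup>2"
  unfolding power2_norm_eq_inner
  by (simp add: inner_diff inner_commute power2_eq_square algebra_simps)

lemma subspace_closure:
  fixes S :: "'a::real_normed_vector set"
  assumes "subspace S"
  shows "subspace (closure S)"
proof (rule subspaceI)
  show "0 \<in> closure S"
    using subspace_0[OF assms] closure_subset by blast
next
  fix x y
  assume "x \<in> closure S" "y \<in> closure S"
  then obtain f g where "\<forall>n. f n \<in> S" "f \<longlonglongrightarrow> x" "\<forall>n. g n \<in> S" "g \<longlonglongrightarrow> y"
    unfolding closure_sequential by blast
  then show "x + y \<in> closure S"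
    unfolding closure_sequential
    by (intro exI[of _ "\<lambda>n. f n + g n"]) (auto intro: tendsto_add subspace_add[OF assms])
next
  fix c x
  assume "x \<in> closure S"
  then obtain f where "\<forall>n. f n \<in> S" "f \<longlonglongrightarrow> x"
    unfolding closure_sequential by blast
  then show "c *\<^sub>R x \<in> closure S"
    unfolding closure_sequential
    by (intro exI[of _ "\<lambda>n. c *\<^sub>R f n"]) (auto intro: tendsto_scaleR subspace_scale[OF assms])
qed

text \<open>Take \<open>s\<close> to be a point of \<open>S\<close> nearest to \<open>x\<close>. It
  exists because minimizing sequences are Cauchy, and \<open>x - s\<close> is orthogonal to
  \<open>S\<close> because moving \<open>s\<close> within \<open>S\<close> cannot reduce the
  distance.\<close>

lemma closed_subspace_decomposition:
  fixes S :: "'a::{real_inner, complete_space} set"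
  assumes S: "subspace S" and "closed S"
  obtains s t where "s \<in> S" and "\<And>u. u \<in> S \<Longrightarrow> inner u t = 0" and "x = s + t"
proof -
  define f where "f y = (norm (x - y))\<^sup>2" for y
  define D where "D = (INF y\<in>S. f y)"
  have "0 \<in> S"
    using S by (rule subspace_0)
  have bdd: "bdd_below (f ` S)"
    by (rule bdd_belowI2[of _ 0]) (simp add: f_def)
  have D_le: "D \<le> f y" if "y \<in> S" for y
    unfolding D_def using bdd that by (rule cINF_lower)
  have "\<exists>y\<in>S. f y < D + inverse (real (Suc n))" for n
  proof -
    have "D < D + inverse (real (Suc n))"
      by simp
    then show ?thesis
      unfolding D_def using cINF_less_iff[OF _ bdd] \<open>0 \<in> S\<close> by blast
  qed
  then obtain y where y: "y n \<in> S" "f (y n) < D + inverse (real (Suc n))" for n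
    by metis
  have y_diff: "(norm (y m - y n))\<^sup>2 < 2 * inverse (real (Suc m)) + 2 * inverse (real (Suc n))" for m n
  proof -
    \<comment> \<open>The midpoint stays in \<open>S\<close>, so its squared distance is at least
      \<open>D\<close>; in the parallelogram law all multiples of \<open>D\<close> then
      cancel.\<close>
    have "(1/2) *\<^sub>R (y m + y n) \<in> S"
      by (intro subspace_scale subspace_add S y)
    then have "D \<le> f ((1/2) *\<^sub>R (y m + y n))"
      by (rule D_le)
    then show ?thesis
      using y(2)[of m] y(2)[of n] norm_diff_midpoint[of "y m" "y n" x] unfolding f_def by linarith
  qed
  have "Cauchy y"
  proof (rule metric_CauchyI)
    fix e :: real
    assume "e > 0"
    \<comment> \<open>Two reciprocals, each doubled in \<open>y_diff\<close>, must add up to less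
      than \<open>e\<^sup>2\<close>.\<close>
    then obtain M where M: "inverse (real (Suc M)) < e\<^sup>2 / 4"
      using reals_Archimedean[of "e\<^sup>2 / 4"] by auto
    have "dist (y m) (y n) < e" if "m \<ge> M" "n \<ge> M" for m n
    proof -
      have "inverse (real (Suc k)) \<le> inverse (real (Suc M))" if "k \<ge> M" for k
        using that by (intro le_imp_inverse_le) auto
      from this[OF that(1)] this[OF that(2)] have "(norm (y m - y n))\<^sup>2 < e\<^sup>2"
        using y_diff[of m n] M by linarith
      then show ?thesis
        using \<open>e > 0\<close> by (simp add: dist_norm power2_less_imp_less)
    qed
    then show "\<exists>M. \<forall>m\<ge>M. \<forall>n\<ge>M. dist (y m) (y n) < e"
      by blast
  qed
  then obtain s where s: "y \<longlonglongrightarrow> s"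
    using Cauchy_convergent convergent_def by blast
  have "s \<in> S"
    using \<open>closed S\<close> y(1) s by (rule closed_sequentially)
  have "f s \<le> D"
  proof (rule LIMSEQ_le)
    show "(\<lambda>n. f (y n)) \<longlonglongrightarrow> f s"
      unfolding f_def by (intro tendsto_intros s)
    show "(\<lambda>n. D + inverse (real (Suc n))) \<longlonglongrightarrow> D"
      using LIMSEQ_inverse_real_of_nat_add by simp
    show "\<exists>N. \<forall>n\<ge>N. f (y n) \<le> D + inverse (real (Suc n))"
      using y(2) less_imp_le by blast
  qed
  have "inner u (x - s) = 0" if "u \<in> S" for u
  proof (cases "u = 0")
    case False
    \<comment> \<open>The minimizer of the quadratic function
      \<open>r \<mapsto> (norm ((x - s) - r *\<^sub>R u))\<^sup>2\<close>; unless the scalar product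
      vanishes, it gives a point of \<open>S\<close> closer to \<open>x\<close> than
      \<open>s\<close>.\<close>
    define r where "r = inner u (x - s) / (norm u)\<^sup>2"
    have "s + r *\<^sub>R u \<in> S"
      by (intro subspace_add subspace_scale S \<open>s \<in> S\<close> that)
    then have "f s \<le> f (s + r *\<^sub>R u)"
      using D_le \<open>f s \<le> D\<close> by fastforce
    also have "f (s + r *\<^sub>R u) = (norm ((x - s) - r *\<^sub>R u))\<^sup>2"
      by (simp add: f_def algebra_simps)
    also have "\<dots> = f s - 2 * r * inner u (x - s) + r\<^sup>2 * (norm u)\<^sup>2"
      unfolding f_def by (rule norm_diff_scaleR)
    also have "\<dots> = f s - (inner u (x - s))\<^sup>2 / (norm u)\<^sup>2"
      using False by (simp add: r_def power2_eq_square field_simps)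
    finally show ?thesis
      using False by (simp add: divide_le_0_iff)
  qed simp
  then show thesis
    using \<open>s \<in> S\<close> that[of s "x - s"] by simp
qed

subsection \<open>Scalar products\<close>

lemma scalar_conj_0 [simp]: "scalar_conj (0::'k::real_or_complex) = 0"
  using scalar_conj_add[of "0::'k" 0] by simp

text \<open>For nonzero \<open>r\<close>, the norm axiom reads
  \<open>r * scalar_conj r = r * r\<close>, and \<open>r\<close> cancels.\<close>

lemma scalar_conj_of_real [simp]: "scalar_conj (of_real r :: 'k::real_or_complex) = of_real r"
proof (cases "r = 0")
  case False
  have "of_real r * scalar_conj (of_real r :: 'k) = of_real r * of_real r"
    by (simp add: mult_scalar_conj power2_eq_square flip: of_real_def)
  then show ?thesis
    using False by simp
qed simp

text \<open>Multiplicativity of the norm gives \<open>(x * y) * scalar_conj (x * y)\<close> the same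
  value as the product of the factors for \<open>x\<close> and \<open>y\<close>; then
  \<open>x * y\<close> cancels.\<close>

lemma scalar_conj_mult:
  "scalar_conj (x * y) = scalar_conj x * scalar_conj (y::'k::real_or_complex)"
proof (cases "x = 0 \<or> y = 0")
  case False
  have "(x * y) * scalar_conj (x * y) = (x * scalar_conj x) * (y * scalar_conj y)"
    by (simp add: mult_scalar_conj norm_mult power_mult_distrib)
  also have "\<dots> = (x * y) * (scalar_conj x * scalar_conj y)"
    by (simp add: ac_simps)
  finally show ?thesis
    using False by simp
qed auto

lemma scalar_conj_eq_0_iff [simp]: "scalar_conj x = 0 \<longleftrightarrow> x = (0::'k::real_or_complex)"
  using mult_scalar_conj[of x] by auto

section \<open>Partial maps described by equations \<open>f x = Some y\<close>\<close>

lemma map_eq_iff_Some: "f = g \<longleftrightarrow> (\<forall>x y. f x = Some y \<longleftrightarrow> g x = Some y)"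
  by (metis ext not_Some_eq)

lemma ball_dom_iff: "(\<forall>x\<in>dom f. P (the (f x)) x) \<longleftrightarrow> (\<forall>x y. f x = Some y \<longrightarrow> P y x)"
  by force

text \<open>Isolates the pattern in the definition of \<open>op_adjoint\<close>: once uniqueness is
  known, the definite description can be replaced by the defining property.\<close>

lemma Ex1_THE_Some_iff:
  assumes "\<And>x y. p x \<Longrightarrow> p y \<Longrightarrow> x = y"
  shows "(if \<exists>!x. p x then Some (THE x. p x) else None) = Some z \<longleftrightarrow> p z"
proof
  assume "(if \<exists>!x. p x then Some (THE x. p x) else None) = Some z"
  then show "p z"
    using theI'[of p] by (auto split: if_splits)
next
  assume "p z"
  then have "\<exists>!x. p x" and "(THE x. p x) = z"
    using assms by blast+
  then show "(if \<exists>!x. p x then Some (THE x. p x) else None) = Some z"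
    by simp
qed

context hilbert_space
begin

lemma ip_0_left [simp]: "ip 0 y = 0"
  using ip_add_left[of 0 0 y] by simp

lemma ip_0_right [simp]: "ip x 0 = 0"
  using ip_commute[of 0 x] by simp

lemma ip_minus_left: "ip (- x) y = - ip x y"
  using ip_add_left[of x "- x" y] minus_unique[of "ip x y" "ip (- x) y"] by simp

lemma ip_add_right: "ip x (y + z) = ip x y + ip x z"
  unfolding ip_commute[of x] ip_add_left scalar_conj_add ..

lemma ip_minus_right: "ip x (- y) = - ip x y"
  using ip_add_right[of x y "- y"] minus_unique[of "ip x y" "ip x (- y)"] by simp

lemma ip_diff_right: "ip x (y - z) = ip x y - ip x z"
  using ip_add_right[of x "y - z" z] by simp

lemma ip_smul_right: "ip x (smul c y) = scalar_conj c * ip x y"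
  unfolding ip_commute[of x] ip_smul_left scalar_conj_mult ..

lemma ip_self_eq_0_iff [simp]: "ip x x = 0 \<longleftrightarrow> x = 0"
  by (simp add: ip_self)

section \<open>The real scalar product as real part of \<open>ip\<close>\<close>

text \<open>Polarization: both scalar products induce the same norm, so the cross terms of the
  square of \<open>x + y\<close> agree.\<close>

lemma ip_add_commuted: "ip x y + ip y x = of_real (2 * inner x y)"
proof -
  have "ip x y + ip y x = ip (x + y) (x + y) - ip x x - ip y y"
    by (simp add: ip_add_left ip_add_right)
  also have "\<dots> = of_real ((norm (x + y))\<^sup>2 - (norm x)\<^sup>2 - (norm y)\<^sup>2)"
    by (simp only: ip_self of_real_diff)
  also have "(norm (x + y))\<^sup>2 - (norm x)\<^sup>2 - (norm y)\<^sup>2 = 2 * inner x y"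
    by (simp add: power2_norm_eq_inner inner_add inner_commute)
  finally show ?thesis .
qed

lemma of_real_inner: "of_real (2 * inner x y) = ip x y + scalar_conj (ip x y)"
  by (simp only: ip_add_commuted[symmetric] ip_commute[of y x])

lemma inner_eq_of_ip_eq:
  assumes "ip x y = ip x' y'"
  shows "inner x y = inner x' y'"
proof -
  have "of_real (2 * inner x y) = (of_real (2 * inner x' y') :: 'k)"
    unfolding of_real_inner assms ..
  then show ?thesis
    by simp
qed

text \<open>Reconciles the scalar multiplication of the locale with that of the type class: both
  vectors have the same real scalar product with every \<open>y\<close>.\<close>

lemma smul_of_real: "smul (of_real r) x = r *\<^sub>R x"
proof -
  have "inner (smul (of_real r) x) y = inner (r *\<^sub>R x) y" for y
  proof -
    have "of_real (2 * inner (smul (of_real r) x) y) = of_real r * (ip x y + ip y x)"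
      unfolding ip_add_commuted[symmetric] by (simp add: ip_smul_left ip_smul_right distrib_left)
    also have "\<dots> = of_real (2 * inner (r *\<^sub>R x) y)"
      by (simp add: ip_add_commuted)
    finally show ?thesis
      by (simp only: of_real_eq_iff)
  qed
  then show ?thesis
    using vector_eq_rdot by blast
qed

lemma subspace_real:
  assumes "subspace S"
  shows "Real_Vector_Spaces.subspace S"
  unfolding Real_Vector_Spaces.subspace_def
  by (metis assms smul_of_real subspace_0 subspace_add subspace_scale)

text \<open>Transfers real orthogonality to \<open>ip\<close>: a nonzero scalar product can be
  rescaled to have nonzero real part.\<close>

lemma ip_eq_0_iff: "ip x y = 0 \<longleftrightarrow> (\<forall>c. inner (smul c x) y = 0)"
proof (intro iffI allI)
  fix c
  assume "ip x y = 0"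
  then show "inner (smul c x) y = 0"
    using inner_eq_of_ip_eq[of "smul c x" y 0 0] by (simp add: ip_smul_left)
next
  assume *: "\<forall>c. inner (smul c x) y = 0"
  show "ip x y = 0"
  proof (rule ccontr)
    assume "ip x y \<noteq> 0"
    \<comment> \<open>Normalized so that \<open>ip z y = 1\<close>, which makes
      \<open>inner z y\<close> equal to 1 rather than 0.\<close>
    define z where "z = smul (inverse (ip x y)) x"
    have "ip z y = 1" and "ip y z = 1"
      using \<open>ip x y \<noteq> 0\<close> ip_commute[of y z] scalar_conj_of_real[of 1, where 'k='k]
      by (simp_all add: z_def ip_smul_left)
    then have "of_real (2 * inner z y) = (2::'k)"
      using ip_add_commuted[of z y] by simp
    moreover have "inner z y = 0"
      using * by (simp add: z_def)
    ultimately show False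
      by simp
  qed
qed

text \<open>An intersection, over all scalars \<open>c\<close>, of kernels of the continuous real
  functionals \<open>inner (smul c x)\<close>.\<close>

lemma closed_ip_eq_0: "closed {y. ip x y = 0}"
proof -
  have "closed {y. inner (smul c x) y = 0}" for c
    by (intro closed_Collect_eq continuous_intros)
  then show ?thesis
    unfolding ip_eq_0_iff by (intro closed_Collect_all) auto
qed

section \<open>Orthogonal complements and density\<close>

lemma closed_orth_compl: "closed (orth_compl ip S)"
proof -
  have "orth_compl ip S = (\<Inter>u\<in>S. {v. ip u v = 0})"
    by (auto simp: orth_compl_def)
  then show ?thesis
    by (simp add: closed_INT closed_ip_eq_0)
qed

lemma ip_eq_0_commute: "ip x y = 0 \<longleftrightarrow> ip y x = 0"
  by (simp only: ip_commute[of x y] scalar_conj_eq_0_iff)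

lemma orth_compl_closure: "orth_compl ip (closure S) = orth_compl ip S"
proof
  show "orth_compl ip S \<subseteq> orth_compl ip (closure S)"
  proof
    fix v
    assume "v \<in> orth_compl ip S"
    then have "S \<subseteq> {u. ip v u = 0}"
      unfolding orth_compl_def ip_eq_0_commute[of v] by blast
    then have "closure S \<subseteq> {u. ip v u = 0}"
      using closed_ip_eq_0 by (rule closure_minimal)
    then show "v \<in> orth_compl ip (closure S)"
      unfolding orth_compl_def ip_eq_0_commute[of v] by blast
  qed
  show "orth_compl ip (closure S) \<subseteq> orth_compl ip S"
    using closure_subset[of S] unfolding orth_compl_def by blast
qed

text \<open>The real projection onto \<open>closure S\<close> suffices: since \<open>S\<close> is
  stable under \<open>smul\<close>, real orthogonality to \<open>S\<close> is orthogonality for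
  \<open>ip\<close>.\<close>

lemma orth_compl_decomposition:
  assumes S: "subspace S"
  obtains s t where "s \<in> closure S" and "t \<in> orth_compl ip S" and "x = s + t"
proof -
  obtain s t where st: "s \<in> closure S" "\<And>u. u \<in> closure S \<Longrightarrow> inner u t = 0" "x = s + t"
    using subspace_closure[OF subspace_real[OF S]] closed_closure
    by (rule closed_subspace_decomposition[where x = x]) blast
  have "inner (smul c u) t = 0" if "u \<in> S" for c u
    using st(2) subspace_scale[OF S that] closure_subset by blast
  then have "t \<in> orth_compl ip S"
    by (simp add: orth_compl_def ip_eq_0_iff)
  with st that show thesis
    by blast
qed

lemma dense_iff_orth_compl:
  assumes "subspace S"
  shows "closure S = UNIV \<longleftrightarrow> orth_compl ip S \<subseteq> {0}"
proof
  assume "closure S = UNIV"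
  then have "orth_compl ip S = orth_compl ip UNIV"
    using orth_compl_closure[of S] by simp
  moreover have "orth_compl ip UNIV \<subseteq> {0}"
  proof
    fix v
    assume "v \<in> orth_compl ip UNIV"
    then have "ip v v = 0"
      unfolding orth_compl_def by blast
    then show "v \<in> {0}"
      by simp
  qed
  ultimately show "orth_compl ip S \<subseteq> {0}"
    by simp
next
  assume 0: "orth_compl ip S \<subseteq> {0}"
  have "x \<in> closure S" for x
  proof -
    obtain s t where "s \<in> closure S" "t \<in> orth_compl ip S" "x = s + t"
      using orth_compl_decomposition[OF assms] .
    with 0 show ?thesis
      by auto
  qed
  then show "closure S = UNIV"
    by blast
qed

subsection \<open>Operators and adjoints\<close>

text \<open>Linearity as stability of the graph under the vector space operations, so that domain
  and value are treated together.\<close>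

lemma linear_operator_iff:
  "linear_operator smul A \<longleftrightarrow> A 0 = Some 0 \<and>
    (\<forall>x a y b. A x = Some a \<longrightarrow> A y = Some b \<longrightarrow> A (x + y) = Some (a + b)) \<and>
    (\<forall>c x a. A x = Some a \<longrightarrow> A (smul c x) = Some (smul c a))"
proof
  assume A: "linear_operator smul A"
  have add: "A (x + y) = Some (a + b)" if "A x = Some a" "A y = Some b" for x a y b
  proof -
    have dom: "x \<in> dom A" "y \<in> dom A"
      using that by auto
    then have "x + y \<in> dom A"
      using A unfolding linear_operator_def by (simp only: subspace_add)
    then obtain c where "A (x + y) = Some c"
      by blast
    moreover have "the (A (x + y)) = the (A x) + the (A y)"
      using A dom by (simp add: linear_operator_def)
    ultimately show ?thesis
      using that by simp
  qed
  moreover have scale: "A (smul c x) = Some (smul c a)" if "A x = Some a" for c x a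
  proof -
    have dom: "x \<in> dom A"
      using that by auto
    then have "smul c x \<in> dom A"
      using A unfolding linear_operator_def by (simp only: subspace_scale)
    then obtain b where "A (smul c x) = Some b"
      by blast
    moreover have "the (A (smul c x)) = smul c (the (A x))"
      using A dom by (simp add: linear_operator_def)
    ultimately show ?thesis
      using that by simp
  qed
  moreover have "A 0 = Some 0"
  proof -
    have "0 \<in> dom A"
      using A by (simp add: linear_operator_def subspace_0)
    then show ?thesis
      using scale[of 0 _ 0] by auto
  qed
  ultimately show "A 0 = Some 0 \<and>
      (\<forall>x a y b. A x = Some a \<longrightarrow> A y = Some b \<longrightarrow> A (x + y) = Some (a + b)) \<and>
      (\<forall>c x a. A x = Some a \<longrightarrow> A (smul c x) = Some (smul c a))"
    by blast
next
  assume A: "A 0 = Some 0 \<and>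
    (\<forall>x a y b. A x = Some a \<longrightarrow> A y = Some b \<longrightarrow> A (x + y) = Some (a + b)) \<and>
    (\<forall>c x a. A x = Some a \<longrightarrow> A (smul c x) = Some (smul c a))"
  then have "subspace (dom A)"
    unfolding subspace_def by blast
  with A show "linear_operator smul A"
    unfolding linear_operator_def by auto
qed

lemma
  assumes "linear_operator smul A"
  shows linear_operator_0: "A 0 = Some 0"
    and linear_operator_add: "A x = Some a \<Longrightarrow> A y = Some b \<Longrightarrow> A (x + y) = Some (a + b)"
    and linear_operator_smul: "A x = Some a \<Longrightarrow> A (smul c x) = Some (smul c a)"
proof -
  note A = assms[unfolded linear_operator_iff]
  show "A 0 = Some 0"
    using A by (rule conjunct1)
  show "A (x + y) = Some (a + b)" if "A x = Some a" "A y = Some b"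
    using A[THEN conjunct2, THEN conjunct1] that by iprover
  show "A (smul c x) = Some (smul c a)" if "A x = Some a"
    using A[THEN conjunct2, THEN conjunct2] that by iprover
qed

lemma linear_operator_minus:
  assumes "linear_operator smul A" and "A x = Some a"
  shows "A (- x) = Some (- a)"
  using linear_operator_smul[OF assms, of "- 1"] by simp

lemma subspace_dom:
  assumes "linear_operator smul A"
  shows "subspace (dom A)"
  using assms by (simp add: linear_operator_def)

lemma linear_operator_comp:
  assumes "linear_operator smul A" and "linear_operator smul B"
  shows "linear_operator smul (A \<circ>\<^sub>m B)"
  unfolding linear_operator_iff map_comp_Some_iff
proof (intro conjI allI impI; (elim exE conjE)?)
  show "\<exists>y. B 0 = Some y \<and> A y = Some 0"
    using linear_operator_0 assms by blast
next
  fix x a y b u v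
  assume "B x = Some u" "A u = Some a" "B y = Some v" "A v = Some b"
  then show "\<exists>z. B (x + y) = Some z \<and> A z = Some (a + b)"
    by (intro exI[of _ "u + v"] conjI linear_operator_add assms)
next
  fix c x a u
  assume "B x = Some u" "A u = Some a"
  then show "\<exists>z. B (smul c x) = Some z \<and> A z = Some (smul c a)"
    by (intro exI[of _ "smul c u"] conjI linear_operator_smul assms)
qed

section \<open>Adjoints of densely defined operators\<close>

lemma ip_right_unique:
  assumes "closure D = UNIV" and "\<And>h. h \<in> D \<Longrightarrow> ip h k = ip h l"
  shows "k = l"
proof -
  have "k - l \<in> orth_compl ip (closure D)"
    unfolding orth_compl_closure using assms(2) by (simp add: orth_compl_def ip_diff_right)
  then have "ip (k - l) (k - l) = 0"
    unfolding assms(1) orth_compl_def by blast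
  then show ?thesis
    by simp
qed

text \<open>Density makes the representing vector unique, so the uniqueness clause in the definition
  of \<open>op_adjoint\<close> disappears.\<close>

lemma op_adjoint_Some_iff:
  assumes "densely_defined A"
  shows "op_adjoint ip A k = Some l \<longleftrightarrow> (\<forall>h a. A h = Some a \<longrightarrow> ip a k = ip h l)"
proof -
  have eq: "(\<forall>h\<in>dom A. ip (the (A h)) k = ip h l) \<longleftrightarrow> (\<forall>h a. A h = Some a \<longrightarrow> ip a k = ip h l)" for l
    by (rule ball_dom_iff[of A "\<lambda>a h. ip a k = ip h l"])
  have unique: "l = l'"
    if "\<forall>h\<in>dom A. ip (the (A h)) k = ip h l" "\<forall>h\<in>dom A. ip (the (A h)) k = ip h l'" for l l'
  proof (rule ip_right_unique)
    show "closure (dom A) = UNIV"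
      using assms by (simp add: densely_defined_def)
    show "ip h l = ip h l'" if "h \<in> dom A" for h
      using bspec[OF \<open>\<forall>h\<in>dom A. ip (the (A h)) k = ip h l\<close> that]
        bspec[OF \<open>\<forall>h\<in>dom A. ip (the (A h)) k = ip h l'\<close> that] by (rule trans[OF sym])
  qed
  show ?thesis
    unfolding op_adjoint_def eq[symmetric] 
    by (rule Ex1_THE_Some_iff[of "\<lambda>l. \<forall>h\<in>dom A. ip (the (A h)) k = ip h l"]) (rule unique)
qed

lemma op_adjointD:
  assumes "densely_defined A" and "op_adjoint ip A k = Some l" and "A h = Some a"
  shows "ip a k = ip h l" and "ip k a = ip l h"
proof -
  show "ip a k = ip h l"
    using assms(2)[unfolded op_adjoint_Some_iff[OF assms(1)]] assms(3) by blast
  then show "ip k a = ip l h"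
    by (simp only: ip_commute[of k a] ip_commute[of l h])
qed

lemma linear_operator_adjoint:
  assumes "densely_defined A"
  shows "linear_operator smul (op_adjoint ip A)"
proof -
  have "op_adjoint ip A 0 = Some 0"
    unfolding op_adjoint_Some_iff[OF assms] by simp
  moreover have "op_adjoint ip A (x + y) = Some (a + b)"
    if "op_adjoint ip A x = Some a" "op_adjoint ip A y = Some b" for x a y b
    unfolding op_adjoint_Some_iff[OF assms] ip_add_right
    using op_adjointD(1)[OF assms that(1)] op_adjointD(1)[OF assms that(2)] by simp
  moreover have "op_adjoint ip A (smul c x) = Some (smul c a)"
    if "op_adjoint ip A x = Some a" for c x a
    unfolding op_adjoint_Some_iff[OF assms] ip_smul_right
    using op_adjointD(1)[OF assms that] by simp
  ultimately show ?thesis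
    unfolding linear_operator_iff by blast
qed

text \<open>The graph of the adjoint is the orthogonal complement of the graph of \<open>A\<close>
  rotated by \<open>(h, a) \<mapsto> (- a, h)\<close>, and orthogonal complements are
  closed.\<close>

lemma closed_operator_adjoint:
  assumes "densely_defined A"
  shows "closed_operator (op_adjoint ip A)"
proof -
  interpret prod: hilbert_space "prod_smul smul" "prod_ip ip"
    by (rule hilbert_space_prod) unfold_locales
  have "Map.graph (op_adjoint ip A) = orth_compl (prod_ip ip) ((\<lambda>(h, a). (- a, h)) ` Map.graph A)"
    by (auto simp: Map.graph_def orth_compl_def prod_ip_def op_adjoint_Some_iff[OF assms]
        ip_minus_left)
  then show ?thesis
    unfolding closed_operator_def by (simp add: prod.closed_orth_compl)
qed

text \<open>Orthogonality of \<open>(a, b)\<close> to all \<open>(h, l)\<close> in the graph is the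
  defining identity of the adjoint at \<open>b\<close>, with value \<open>- a\<close>. This connects
  the range conditions with adjoints.\<close>

lemma orth_compl_graph_iff:
  assumes "densely_defined A"
  shows "(a, b) \<in> orth_compl (prod_ip ip) (Map.graph A) \<longleftrightarrow> op_adjoint ip A b = Some (- a)"
proof -
  have "ip h a + ip l b = 0 \<longleftrightarrow> ip l b = ip h (- a)" for h l
    unfolding ip_minus_right by (rule add_eq_0_iff)
  then show ?thesis
    unfolding op_adjoint_Some_iff[OF assms]
    by (simp add: orth_compl_def prod_ip_def Map.graph_def)
qed

lemma subspace_graph:
  assumes "linear_operator smul A"
  shows "module.subspace (prod_smul smul) (Map.graph A)"
proof -
  interpret prod: hilbert_space "prod_smul smul" "prod_ip ip"
    by (rule hilbert_space_prod) unfold_locales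
  show ?thesis
  proof (rule prod.subspaceI)
    show "0 \<in> Map.graph A"
      using linear_operator_0[OF assms] by (simp add: Map.graph_def zero_prod_def)
  next
    fix u v
    assume "u \<in> Map.graph A" and "v \<in> Map.graph A"
    then obtain x a y b where "u = (x, a)" "A x = Some a" "v = (y, b)" "A y = Some b"
      unfolding Map.graph_def by blast
    then show "u + v \<in> Map.graph A"
      using linear_operator_add[OF assms] by (simp add: Map.graph_def)
  next
    fix c u
    assume "u \<in> Map.graph A"
    then obtain x a where "u = (x, a)" "A x = Some a"
      unfolding Map.graph_def by blast
    then show "prod_smul smul c u \<in> Map.graph A"
      using linear_operator_smul[OF assms] by (simp add: Map.graph_def prod_smul_def)
  qed
qed

lemma linear_operator_diff:
  assumes "linear_operator smul A" and "A x = Some a" and "A y = Some b"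
  shows "A (x - y) = Some (a - b)"
  using linear_operator_add[OF assms(1,2) linear_operator_minus[OF assms(1,3)]] by simp

section \<open>Formal adjointness and the range conditions\<close>

lemma adjoint_to_each_other_iff:
  "adjoint_to_each_other ip A B \<longleftrightarrow> (\<forall>h a k b. A h = Some a \<longrightarrow> B k = Some b \<longrightarrow> ip a k = ip h b)"
  unfolding adjoint_to_each_other_def by (auto simp: dom_def)

lemma adjoint_to_each_otherD:
  assumes "adjoint_to_each_other ip A B" and "A h = Some a" and "B k = Some b"
  shows "ip a k = ip h b"
  using assms unfolding adjoint_to_each_other_iff by blast

lemma adjoint_to_each_other_sym:
  assumes "adjoint_to_each_other ip A B"
  shows "adjoint_to_each_other ip B A"
  unfolding adjoint_to_each_other_iff
proof (intro allI impI)
  fix k b h a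
  assume "B k = Some b" and "A h = Some a"
  then have "ip a k = ip h b"
    using adjoint_to_each_otherD[OF assms] by blast
  then show "ip b h = ip k a"
    by (simp only: ip_commute[of b h] ip_commute[of k a])
qed

lemma adjoint_to_each_other_op_adjoint:
  assumes "densely_defined A"
  shows "adjoint_to_each_other ip A (op_adjoint ip A)"
  unfolding adjoint_to_each_other_iff using op_adjointD(1)[OF assms] by blast

lemma op_adjoint_extends:
  assumes "densely_defined A" and "adjoint_to_each_other ip A B" and "B k = Some b"
  shows "op_adjoint ip A k = Some b"
  unfolding op_adjoint_Some_iff[OF assms(1)] using adjoint_to_each_otherD[OF assms(2)] assms(3) by blast

text \<open>Both conclusions follow from \<open>B v = Some (- u)\<close> for every
  \<open>(u, v)\<close> orthogonal to the graph of \<open>A\<close>: pairs \<open>(y, 0)\<close>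
  give density, pairs \<open>(- l, k)\<close> the domain and values of the adjoint.\<close>

lemma op_adjoint_eq_of_orth_compl_graph:
  assumes A: "linear_operator smul A" and B: "linear_operator smul B"
    and adj: "adjoint_to_each_other ip A B"
    and ran: "orth_compl (prod_ip ip) (Map.graph A) \<subseteq> ran (block_operator A B)"
  shows "densely_defined A" and "op_adjoint ip A = B"
proof -
  have B_eq: "B v = Some (- u)" if uv: "(u, v) \<in> orth_compl (prod_ip ip) (Map.graph A)" for u v
  proof -
    obtain h a k b where hk: "A h = Some a" "B k = Some b" "u = h - b" "v = a + k"
      using subsetD[OF ran uv] by (auto simp: ran_def block_operator_def split: if_splits)
    have "(h, a) \<in> Map.graph A"
      using hk(1) by (simp add: Map.graph_def)
    then have "ip h u + ip a v = 0"
      using uv by (force simp: orth_compl_def prod_ip_def)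
    \<comment> \<open>Formal adjointness cancels the mixed terms \<open>- ip h b\<close> and
      \<open>ip a k\<close>.\<close>
    then have "ip h h + ip a a = 0"
      using adjoint_to_each_otherD[OF adj hk(1,2)] by (simp add: hk(3,4) ip_diff_right ip_add_right)
    then have "of_real ((norm h)\<^sup>2 + (norm a)\<^sup>2) = (0::'k)"
      by (simp only: ip_self of_real_add)
    then have "h = 0" and "a = 0"
      unfolding of_real_eq_0_iff by (simp_all add: sum_power2_eq_zero_iff)
    then show ?thesis
      using hk by simp
  qed
  have "orth_compl ip (dom A) \<subseteq> {0}"
  proof
    fix y
    assume "y \<in> orth_compl ip (dom A)"
    then have "(y, 0) \<in> orth_compl (prod_ip ip) (Map.graph A)"
      by (auto simp: orth_compl_def prod_ip_def Map.graph_def)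
    \<comment> \<open>Here \<open>B 0 = Some (- y)\<close>, while linearity gives
      \<open>B 0 = Some 0\<close>.\<close>
    then show "y \<in> {0}"
      using B_eq linear_operator_0[OF B] by force
  qed
  then show dense: "densely_defined A"
    unfolding densely_defined_def using dense_iff_orth_compl[OF subspace_dom[OF A]] by blast
  show "op_adjoint ip A = B"
    unfolding map_eq_iff_Some
  proof (intro allI iffI)
    fix k l
    assume "op_adjoint ip A k = Some l"
    then have "(- l, k) \<in> orth_compl (prod_ip ip) (Map.graph A)"
      by (simp add: orth_compl_graph_iff[OF dense])
    then show "B k = Some l"
      using B_eq by fastforce
  qed (rule op_adjoint_extends[OF dense adj])
qed

text \<open>An element \<open>(u, v)\<close> of the complement has \<open>- u\<close> as value of
  the adjoint at \<open>v\<close>, so it is the image of \<open>(0, v)\<close>.\<close>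

lemma orth_compl_graph_subset_ran:
  assumes "linear_operator smul A" and "densely_defined A"
  shows "orth_compl (prod_ip ip) (Map.graph A) \<subseteq> ran (block_operator A (op_adjoint ip A))"
proof
  fix w
  assume w: "w \<in> orth_compl (prod_ip ip) (Map.graph A)"
  obtain u v where [simp]: "w = (u, v)"
    by (cases w)
  have "op_adjoint ip A v = Some (- u)"
    using w by (simp add: orth_compl_graph_iff[OF assms(2)])
  then have "block_operator A (op_adjoint ip A) (0, v) = Some w"
    using linear_operator_0[OF assms(1)] by (simp add: block_operator_def domI)
  then show "w \<in> ran (block_operator A (op_adjoint ip A))"
    by (rule ranI)
qed

text \<open>The two preceding lemmas, applied to both orders of \<open>A\<close> and
  \<open>B\<close>. Density belongs to the left side and is extracted from the range conditions on
  the right.\<close>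

lemma adjoint_of_each_other_iff:
  assumes "linear_operator smul A" and "linear_operator smul B"
  shows "adjoint_of_each_other ip A B \<longleftrightarrow>
    adjoint_to_each_other ip A B \<and>
    orth_compl (prod_ip ip) (Map.graph A) \<subseteq> ran (block_operator A B) \<and>
    orth_compl (prod_ip ip) (Map.graph B) \<subseteq> ran (block_operator B A)"
  unfolding adjoint_of_each_other_def
  using op_adjoint_eq_of_orth_compl_graph[OF assms]
    op_adjoint_eq_of_orth_compl_graph[OF assms(2,1) adjoint_to_each_other_sym]
    orth_compl_graph_subset_ran[OF assms(1)] orth_compl_graph_subset_ran[OF assms(2)]
    adjoint_to_each_other_op_adjoint[of A]
  by auto

section \<open>Selfadjointness and surjectivity of \<open>I + A\<close>\<close>

text \<open>To compare a vector \<open>k\<close> in the domain of the adjoint with the domain of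
  \<open>A\<close>, solve \<open>z + A z = k + l\<close>, where \<open>l\<close> is the value of the
  adjoint at \<open>k\<close>. By symmetry \<open>z - k\<close> is orthogonal to the range of
  \<open>I + A\<close>, hence zero. Density follows by the same comparison.\<close>

lemma selfadjointI:
  assumes A: "linear_operator smul A" and adj: "adjoint_to_each_other ip A A"
    and surj: "\<And>x. \<exists>h a. A h = Some a \<and> x = h + a"
  shows "selfadjoint ip A"
proof -
  have eq: "z = k"
    if zk: "A z = Some c" "\<And>h a. A h = Some a \<Longrightarrow> ip (h + a) k = ip h (z + c)" for z c k
  proof -
    have "ip x (z - k) = 0" for x
    proof -
      obtain h a where "A h = Some a" "x = h + a"
        using surj by blast
      then show ?thesis
        using zk(2)[of h a] adjoint_to_each_otherD[OF adj _ zk(1), of h a]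
        by (simp add: ip_diff_right ip_add_left ip_add_right)
    qed
    from this[of "z - k"] show ?thesis
      by simp
  qed
  have "orth_compl ip (dom A) \<subseteq> {0}"
  proof
    fix y
    assume y: "y \<in> orth_compl ip (dom A)"
    obtain z c where z: "A z = Some c" "y = z + c"
      using surj by blast
    \<comment> \<open>The comparison \<open>eq\<close> with \<open>k = 0\<close>: both of its sides
      vanish because \<open>y = z + c\<close> is orthogonal to the domain.\<close>
    have "z = 0"
      using y by (intro eq[OF z(1)]) (auto simp: orth_compl_def simp flip: z(2))
    then show "y \<in> {0}"
      using z linear_operator_0[OF A] by simp
  qed
  then have dense: "densely_defined A"
    unfolding densely_defined_def using dense_iff_orth_compl[OF subspace_dom[OF A]] by blast
  have "op_adjoint ip A = A"
    unfolding map_eq_iff_Some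
  proof (intro allI iffI)
    fix k l
    assume kl: "op_adjoint ip A k = Some l"
    obtain z c where z: "A z = Some c" "k + l = z + c"
      using surj by blast
    have "z = k"
      using op_adjointD(1)[OF dense kl]
      by (intro eq[OF z(1)]) (simp add: ip_add_left ip_add_right flip: z(2))
    with z show "A k = Some l"
      by simp
  qed (rule op_adjoint_extends[OF dense adj])
  with dense show ?thesis
    by (simp add: selfadjoint_def)
qed

text \<open>The range of \<open>I + A\<close> is dense, since a vector \<open>t\<close> orthogonal
  to it satisfies \<open>A t = - t\<close>, which positivity allows only for \<open>t = 0\<close>.
  It is closed, since \<open>norm h \<le> norm (h + A h)\<close> makes preimages of convergent
  sequences converge and \<open>A\<close> is closed.\<close>

lemma selfadjoint_add_surj:
  assumes A: "linear_operator smul A" and sa: "selfadjoint ip A"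
    and pos: "\<And>h a. A h = Some a \<Longrightarrow> inner a h \<ge> 0"
  shows "\<exists>h a. A h = Some a \<and> x = h + a"
proof -
  have dense: "densely_defined A" and adj: "op_adjoint ip A = A"
    using sa by (simp_all add: selfadjoint_def)
  have closed: "closed (Map.graph A)"
    using closed_operator_adjoint[OF dense] by (simp add: adj closed_operator_def)
  define R where "R = {h + a | h a. A h = Some a}"
  have "subspace R"
  proof (rule subspaceI)
    show "0 \<in> R"
      unfolding R_def using linear_operator_0[OF A] by force
  next
    fix u v
    assume "u \<in> R" and "v \<in> R"
    then obtain h a k b where "A h = Some a" "u = h + a" "A k = Some b" "v = k + b"
      unfolding R_def by blast
    then have "A (h + k) = Some (a + b)" and "u + v = (h + k) + (a + b)"
      using linear_operator_add[OF A] by auto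
    then show "u + v \<in> R"
      unfolding R_def by blast
  next
    fix c u
    assume "u \<in> R"
    then obtain h a where "A h = Some a" "u = h + a"
      unfolding R_def by blast
    then have "A (smul c h) = Some (smul c a)" and "smul c u = smul c h + smul c a"
      using linear_operator_smul[OF A] by (auto simp: scale_right_distrib)
    then show "smul c u \<in> R"
      unfolding R_def by blast
  qed
  then obtain s t where st: "s \<in> closure R" "t \<in> orth_compl ip R" "x = s + t"
    by (rule orth_compl_decomposition)
  have "op_adjoint ip A t = Some (- t)"
    unfolding op_adjoint_Some_iff[OF dense]
  proof (intro allI impI)
    fix h a
    assume "A h = Some a"
    then have "ip (h + a) t = 0"
      using st(2) unfolding orth_compl_def R_def by blast
    then show "ip a t = ip h (- t)"
      by (simp add: ip_add_left ip_minus_right add_eq_0_iff)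
  qed
  then have "inner (- t) t \<ge> 0"
    unfolding adj by (rule pos)
  then have "inner t t \<le> 0"
    by simp
  then have "t = 0"
    using inner_gt_zero_iff[of t] by linarith
  with st have "x \<in> closure R"
    by simp
  then obtain f where f: "\<And>n. f n \<in> R" "f \<longlonglongrightarrow> x"
    unfolding closure_sequential by blast
  then have "\<exists>h a. A h = Some a \<and> f n = h + a" for n
    unfolding R_def by blast
  then obtain h a where ha: "\<And>n. A (h n) = Some (a n)" "\<And>n. f n = h n + a n"
    by metis
  \<comment> \<open>In the expanded square of the right side, positivity of \<open>A\<close> makes
    the cross term nonnegative.\<close>
  have norm_le: "norm (h m - h n) \<le> norm (f m - f n)" for m n
  proof (rule power2_le_imp_le)
    have "f m - f n = (h m - h n) + (a m - a n)"
      by (simp add: ha(2))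
    then have "(norm (f m - f n))\<^sup>2 =
        (norm (h m - h n))\<^sup>2 + 2 * inner (a m - a n) (h m - h n) + (norm (a m - a n))\<^sup>2"
      unfolding power2_norm_eq_inner by (simp only: inner_add inner_commute[of "h m - h n" "a m - a n"])
    moreover have "inner (a m - a n) (h m - h n) \<ge> 0"
      by (intro pos linear_operator_diff A ha)
    ultimately show "(norm (h m - h n))\<^sup>2 \<le> (norm (f m - f n))\<^sup>2"
      by simp
  qed simp
  have "Cauchy h"
  proof (rule metric_CauchyI)
    fix e :: real
    assume "e > 0"
    then obtain M where "\<forall>m\<ge>M. \<forall>n\<ge>M. dist (f m) (f n) < e"
      using LIMSEQ_imp_Cauchy[OF f(2)] unfolding Cauchy_def by blast
    then have "\<forall>m\<ge>M. \<forall>n\<ge>M. dist (h m) (h n) < e"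
      unfolding dist_norm using norm_le le_less_trans by blast
    then show "\<exists>M. \<forall>m\<ge>M. \<forall>n\<ge>M. dist (h m) (h n) < e"
      by blast
  qed
  then obtain z where z: "h \<longlonglongrightarrow> z"
    using Cauchy_convergent convergent_def by blast
  have "(\<lambda>n. f n - h n) \<longlonglongrightarrow> x - z"
    by (intro tendsto_diff f z)
  then have "a \<longlonglongrightarrow> x - z"
    by (simp add: ha(2))
  then have lim: "(\<lambda>n. (h n, a n)) \<longlonglongrightarrow> (z, x - z)"
    using z by (rule tendsto_Pair[rotated])
  have "(h n, a n) \<in> Map.graph A" for n
    using ha(1) by (simp add: Map.graph_def)
  with closed have "(z, x - z) \<in> Map.graph A"
    using lim by (rule closed_sequentially)
  then have "A z = Some (x - z)" and "x = z + (x - z)"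
    by (auto simp: Map.graph_def)
  then show ?thesis
    by blast
qed

subsection \<open>Products with the adjoint\<close>

text \<open>Moving one factor across the scalar product turns both sides into the same product of
  images under \<open>N\<close>, respectively under its adjoint.\<close>

lemma adjoint_to_each_other_products:
  assumes "densely_defined N"
  shows "adjoint_to_each_other ip (op_adjoint ip N \<circ>\<^sub>m N) (op_adjoint ip N \<circ>\<^sub>m N)"
    and "adjoint_to_each_other ip (N \<circ>\<^sub>m op_adjoint ip N) (N \<circ>\<^sub>m op_adjoint ip N)"
  unfolding adjoint_to_each_other_iff map_comp_Some_iff
  using op_adjointD[OF assms] by metis+

text \<open>The scalar product is the squared norm of the intermediate vector \<open>b\<close>, the
  image of \<open>h\<close> under the first factor applied.\<close>

lemma inner_products_nonneg:
  assumes "densely_defined N"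
  shows "(op_adjoint ip N \<circ>\<^sub>m N) h = Some a \<Longrightarrow> inner a h \<ge> 0"
    and "(N \<circ>\<^sub>m op_adjoint ip N) h = Some a \<Longrightarrow> inner a h \<ge> 0"
proof -
  assume "(op_adjoint ip N \<circ>\<^sub>m N) h = Some a"
  then obtain b where "N h = Some b" "op_adjoint ip N b = Some a"
    unfolding map_comp_Some_iff by blast
  then have "ip b b = ip a h"
    using op_adjointD(2)[OF assms] by blast
  then show "inner a h \<ge> 0"
    using inner_eq_of_ip_eq inner_ge_zero by metis
next
  assume "(N \<circ>\<^sub>m op_adjoint ip N) h = Some a"
  then obtain b where "op_adjoint ip N h = Some b" "N b = Some a"
    unfolding map_comp_Some_iff by blast
  then have "ip a h = ip b b"
    using op_adjointD(1)[OF assms] by blast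
  then show "inner a h \<ge> 0"
    using inner_eq_of_ip_eq inner_ge_zero by metis
qed

text \<open>
  Both directions rest on the splitting of \<open>(x, 0)\<close> and \<open>(0, x)\<close> along the graph of \<open>N\<close> and its
  orthogonal complement, the rotated graph of the adjoint.
\<close>

lemma closed_operator_iff_add_surj:
  assumes N: "linear_operator smul N" and dense: "densely_defined N"
  defines "P \<equiv> op_adjoint ip N \<circ>\<^sub>m N" and "Q \<equiv> N \<circ>\<^sub>m op_adjoint ip N"
  shows "closed_operator N \<longleftrightarrow>
    (\<forall>x. \<exists>h a. P h = Some a \<and> x = h + a) \<and> (\<forall>x. \<exists>h a. Q h = Some a \<and> x = h + a)"
proof -
  interpret prod: hilbert_space "prod_smul smul" "prod_ip ip"
    by (rule hilbert_space_prod) unfold_locales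
  let ?adj = "op_adjoint ip N"
  let ?G = "Map.graph N"
  note adj = linear_operator_adjoint[OF dense]
  show ?thesis
  proof (intro iffI conjI allI)
    fix x
    assume "closed_operator N"
    then have split: "\<exists>h b u v. N h = Some b \<and> ?adj v = Some (- u) \<and> w = (h + u, b + v)" for w
    proof -
      obtain s t where "s \<in> closure ?G" "t \<in> orth_compl (prod_ip ip) ?G" "w = s + t"
        using subspace_graph[OF N] by (rule prod.orth_compl_decomposition)
      moreover obtain h b u v where "s = (h, b)" "t = (u, v)"
        by (cases s, cases t)
      moreover have "closure ?G = ?G"
        using \<open>closed_operator N\<close> by (simp add: closed_operator_def)
      ultimately have "(h, b) \<in> ?G" "?adj v = Some (- u)" "w = (h + u, b + v)"
        by (simp_all add: orth_compl_graph_iff[OF dense])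
      then have "N h = Some b" "?adj v = Some (- u)" "w = (h + u, b + v)"
        by (simp_all add: Map.graph_def)
      then show ?thesis
        by blast
    qed
    show "\<exists>h a. P h = Some a \<and> x = h + a"
    proof -
      obtain h b u v where "N h = Some b" "?adj v = Some (- u)" "(x, 0) = (h + u, b + v)"
        using split by blast
      \<comment> \<open>The second component gives \<open>v = - b\<close>, so \<open>b = N h\<close>
        lies in the domain of the adjoint.\<close>
      moreover from this have "?adj b = Some u"
        using linear_operator_minus[OF adj, of v "- u"] by (simp add: add_eq_0_iff)
      ultimately have "P h = Some u" "x = h + u"
        by (auto simp: P_def map_comp_Some_iff)
      then show ?thesis
        by blast
    qed
    show "\<exists>h a. Q h = Some a \<and> x = h + a"
    proof -
      obtain h b u v where *: "N h = Some b" "?adj v = Some (- u)" "(0, x) = (h + u, b + v)"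
        using split by blast
      \<comment> \<open>Thus the adjoint maps \<open>v\<close> to \<open>h\<close>, and
        \<open>N\<close> maps \<open>h\<close> to \<open>b\<close>.\<close>
      then have "- u = h"
        by (simp add: eq_neg_iff_add_eq_0[symmetric])
      with * have "Q v = Some b" "x = v + b"
        by (auto simp: Q_def map_comp_Some_iff)
      then show ?thesis
        by blast
    qed
  next
    assume surj: "(\<forall>x. \<exists>h a. P h = Some a \<and> x = h + a) \<and> (\<forall>x. \<exists>h a. Q h = Some a \<and> x = h + a)"
    have "closure ?G \<subseteq> ?G"
    proof
      fix w
      assume w: "w \<in> closure ?G"
      obtain x y where [simp]: "w = (x, y)"
        by (cases w)
      obtain h b p where p: "N h = Some b" "?adj b = Some p" "x = h + p"
        using surj unfolding P_def map_comp_Some_iff by blast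
      obtain k c q where q: "?adj k = Some c" "N c = Some q" "y = k + q"
        using surj unfolding Q_def map_comp_Some_iff by blast
      \<comment> \<open>The candidate for the projection of \<open>w\<close> onto the graph:
        \<open>N\<close> maps \<open>h + c\<close> to \<open>b + q\<close>, and the remainder
        \<open>(p - c, k - b)\<close> is orthogonal to the graph because the adjoint maps
        \<open>k - b\<close> to \<open>c - p\<close>.\<close>
      define g where "g = (h + c, b + q)"
      have g: "g \<in> ?G"
        using linear_operator_add[OF N p(1) q(2)] by (simp add: g_def Map.graph_def)
      have wg: "w - g = (p - c, k - b)"
        by (simp add: g_def p q)
      have "w - g \<in> orth_compl (prod_ip ip) ?G"
        unfolding wg orth_compl_graph_iff[OF dense]
        using linear_operator_diff[OF adj q(1) p(2)] by simp
      then have "w - g \<in> orth_compl (prod_ip ip) (closure ?G)"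
        by (simp only: prod.orth_compl_closure)
      moreover have "w - g \<in> closure ?G"
        using g closure_subset
        by (intro Real_Vector_Spaces.subspace_diff subspace_closure prod.subspace_real subspace_graph N w) blast
      \<comment> \<open>The remainder lies both in the closure of the graph and in its orthogonal
        complement.\<close>
      ultimately have "prod_ip ip (w - g) (w - g) = 0"
        unfolding orth_compl_def by blast
      then show "w \<in> ?G"
        using g by simp
    qed
    then show "closed_operator N"
      unfolding closed_operator_def using closure_subset_eq by blast
  qed
qed

end

theorem theorem9p1:
  fixes smul :: "'k::real_or_complex \<Rightarrow> 'a::{real_inner, banach} \<Rightarrow> 'a"
    and ip :: "'a \<Rightarrow> 'a \<Rightarrow> 'k"
    and N :: "'a \<rightharpoonup> 'a"
  assumes "hilbert_space smul ip"
    and "linear_operator smul N"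
    and "densely_defined N"
  defines "P \<equiv> op_adjoint ip N \<circ>\<^sub>m N"
    and "Q \<equiv> N \<circ>\<^sub>m op_adjoint ip N"
  shows "(normal_operator ip N \<longleftrightarrow> selfadjoint ip P \<and> selfadjoint ip Q \<and> P = Q) \<and>
    (normal_operator ip N \<longleftrightarrow> adjoint_of_each_other ip P Q) \<and>
    (normal_operator ip N \<longleftrightarrow>
      adjoint_to_each_other ip P Q \<and>
      orth_compl (prod_ip ip) (Map.graph P) \<subseteq> ran (block_operator P Q) \<and>
      orth_compl (prod_ip ip) (Map.graph Q) \<subseteq> ran (block_operator Q P))"
proof -
  interpret hilbert_space smul ip
    by fact
  note N = assms(2) and dense = assms(3)
  have lin: "linear_operator smul P" "linear_operator smul Q"
    unfolding P_def Q_def by (intro linear_operator_comp linear_operator_adjoint N dense)+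
  have sym: "adjoint_to_each_other ip P P" "adjoint_to_each_other ip Q Q"
    unfolding P_def Q_def by (rule adjoint_to_each_other_products[OF dense])+
  \<comment> \<open>Surjectivity of \<open>I + P\<close> and \<open>I + Q\<close> is the link: with
    symmetry it yields selfadjointness, and with positivity it follows from selfadjointness.\<close>
  have closed_iff: "closed_operator N \<longleftrightarrow> selfadjoint ip P \<and> selfadjoint ip Q"
  proof
    assume "closed_operator N"
    then show "selfadjoint ip P \<and> selfadjoint ip Q"
      using closed_operator_iff_add_surj[OF N dense] selfadjointI[OF lin(1) sym(1)]
        selfadjointI[OF lin(2) sym(2)] unfolding P_def Q_def by blast
  next
    assume "selfadjoint ip P \<and> selfadjoint ip Q"
    then show "closed_operator N"
      using closed_operator_iff_add_surj[OF N dense] selfadjoint_add_surj[OF lin(1)]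
        selfadjoint_add_surj[OF lin(2)] inner_products_nonneg[OF dense] unfolding P_def Q_def by blast
  qed
  have normal_iff: "normal_operator ip N \<longleftrightarrow> selfadjoint ip P \<and> selfadjoint ip Q \<and> P = Q"
    unfolding normal_operator_def closed_iff using dense by (auto simp: P_def Q_def)
  moreover have "selfadjoint ip P \<and> selfadjoint ip Q \<and> P = Q \<longleftrightarrow> adjoint_of_each_other ip P Q"
  proof
    assume adj: "adjoint_of_each_other ip P Q"
    then have "densely_defined P" "densely_defined Q" "op_adjoint ip P = Q" "op_adjoint ip Q = P"
      by (simp_all add: adjoint_of_each_other_def)
    \<comment> \<open>By symmetry the adjoint of \<open>P\<close>, which is \<open>Q\<close>,
      extends \<open>P\<close>; likewise \<open>P\<close> extends \<open>Q\<close>.\<close>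
    moreover from this have "P = Q"
      unfolding map_eq_iff_Some using op_adjoint_extends[OF _ sym(1)] op_adjoint_extends[OF _ sym(2)]
      by metis
    ultimately show "selfadjoint ip P \<and> selfadjoint ip Q \<and> P = Q"
      by (simp add: selfadjoint_def)
  qed (auto simp: selfadjoint_def adjoint_of_each_other_def)
  ultimately show ?thesis
    using adjoint_of_each_other_iff[OF lin] by blast
qed

end
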